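(* Let $m,n$ be positive integers, $K=[n-1]$, and let $\gamma=(\gamma_{ij}:i\in[m],j\in[n])$ be a nonnegative vector. For each $j\in K$ let $S_j,T_j$ be integers with $0\le S_j\le T_j\le m$. For $A\subseteq[m]$ set $$f(A)=\sum\Bigl\{\prod_{i\in A}\gamma_{i,\sigma(i)}\ :\ \sigma\in K^A,\ S_j\le|\sigma^{-1}(j)|\le T_j\ \ \forall j\in K\Bigr\}.$$ Then $f$ satisfies the negative lattice condition: $$f(A\cup B)\,f(A\cap B)\le f(A)\,f(B)\qquad\text{for all }A,B\subseteq[m].$$
   Context: $[m]=\{1,\dots,m\}$; $K^A$ is the set of functions $\sigma:A\to K$, and $\sigma^{-1}(j)=\{i\in A:\sigma(i)=j\}$. *)

theory Defs
  imports Complex_Main "HOL-Library.FuncSet"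
begin

text \<open>The set of all functions from \<open>A\<close> to \<open>K\<close> is rendered by the extensional function space
  \<open>A \<rightarrow>\<^sub>E K\<close>, so that each such function is counted exactly once in the sum.\<close>

definition occupancy_sum ::
  "nat set \<Rightarrow> (nat \<Rightarrow> nat \<Rightarrow> real) \<Rightarrow> (nat \<Rightarrow> int) \<Rightarrow> (nat \<Rightarrow> int) \<Rightarrow> nat set \<Rightarrow> real" where
  "occupancy_sum K \<gamma> S T A =
     (\<Sum>\<sigma> | \<sigma> \<in> A \<rightarrow>\<^sub>E K \<and>
            (\<forall>j\<in>K. S j \<le> int (card {i \<in> A. \<sigma> i = j}) \<and> int (card {i \<in> A. \<sigma> i = j}) \<le> T j).
        \<Prod>i\<in>A. \<gamma> i (\<sigma> i))"

definition negative_lattice_condition :: "'a set \<Rightarrow> ('a set \<Rightarrow> real) \<Rightarrow> bool" where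
  "negative_lattice_condition E f \<longleftrightarrow>
     (\<forall>A B. A \<subseteq> E \<longrightarrow> B \<subseteq> E \<longrightarrow> f (A \<union> B) * f (A \<inter> B) \<le> f A * f B)"

end

theory Submission
  imports Defs "HOL-Library.Function_Algebras"
begin

text \<open>
  Read a pair \<open>\<sigma> \<in> K\<^sup>A\<close>, \<open>\<tau> \<in> K\<^sup>B\<close> as an oriented multigraph on the urns: a ball \<open>i \<in> A \<inter> B\<close> is an
  edge from \<open>\<sigma> i\<close> to \<open>\<tau> i\<close>, and a ball of the symmetric difference is a half-edge. Reversing edges keeps
  the weight, and with the total degrees fixed the bounds on both occupancies become
  \<open>\<bar>outdegree - indegree\<bar> \<le> c v\<close> at every urn \<open>v\<close>. The half-edges only contribute a fixed initial
  excess, so the theorem follows if, for each graph, the number of admissible orientations with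
  initial excess \<open>x\<close> is at most the number with initial excess \<open>y\<close> whenever \<open>\<bar>y\<bar> \<le> x\<close> pointwise with equal
  parities.

  This is proved by induction on the number of vertices and, within it, on the number of vertices
  with \<open>x v \<noteq> 0\<close>. Delete such a vertex \<open>v\<close> and sort the orientations by the total sign \<open>s\<close> at the far ends of
  its edges. Averaging over all ways of splicing pairs of oppositely oriented edges at \<open>v\<close> into single
  edges of the smaller graph shows that the count for \<open>x\<close> at \<open>s\<close> is at most the count for \<open>y\<close> at \<open>t\<close> if
  \<open>\<bar>t\<bar> \<le> s\<close>. The vertex allows \<open>s \<in> [x v - c v, x v + c v]\<close> on the left and \<open>[y v - c v, y v + c v]\<close> on
  the right; reflecting one interval onto the other settles all \<open>s\<close> outside the symmetric block
  \<open>[x v - c v, c v - x v]\<close>, and on that block the sums are the counts for the same graph with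
  \<open>x v = y v = 0\<close> and bound \<open>c v - x v\<close>.
\<close>

section \<open>Constrained orientations of a multigraph\<close>

definition unit_vec :: "'v \<Rightarrow> 'v \<Rightarrow> int" where
  "unit_vec u = (\<lambda>w. if w = u then 1 else 0)"

text \<open>Counts the orientations of the edges \<open>es\<close> for which \<open>k\<close> plus the outdegree minus the indegree has
  absolute value at most \<open>c\<close> on \<open>V\<close>; vertices outside \<open>V\<close> are unconstrained.\<close>
primrec orient :: "'v set \<Rightarrow> ('v \<Rightarrow> int) \<Rightarrow> ('v \<times> 'v) list \<Rightarrow> ('v \<Rightarrow> int) \<Rightarrow> real" where
  "orient V c [] k = (if \<forall>v\<in>V. \<bar>k v\<bar> \<le> c v then 1 else 0)"
| "orient V c (e # es) k =
     orient V c es (k + unit_vec (fst e) - unit_vec (snd e)) +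
     orient V c es (k - unit_vec (fst e) + unit_vec (snd e))"

text \<open>Parity matters: with \<open>V = {v}\<close>, one edge from \<open>v\<close> to another
  vertex and \<open>c v = 0\<close>, the excess \<open>x v = 1\<close> admits one orientation and
  \<open>y v = 0\<close> admits none.\<close>

definition dominates :: "('v \<Rightarrow> int) \<Rightarrow> ('v \<Rightarrow> int) \<Rightarrow> bool" where
  "dominates x y \<longleftrightarrow> (\<forall>v. \<bar>y v\<bar> \<le> x v \<and> even (x v - y v))"

definition signed_sum :: "('i \<Rightarrow> 'v) \<Rightarrow> 'i set \<Rightarrow> 'i set \<Rightarrow> 'v \<Rightarrow> int" where
  "signed_sum u I Z = (\<Sum>i\<in>I. if i \<in> Z then unit_vec (u i) else - unit_vec (u i))"

lemma orient_nonneg: "0 \<le> orient V c es k"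
  by (induction es arbitrary: k) auto

lemma orient_cong:
  assumes "\<And>v. v \<in> V \<Longrightarrow> k v = l v" "\<And>v. v \<in> V \<Longrightarrow> c v = d v"
  shows "orient V c es k = orient V d es l"
  using assms
proof (induction es arbitrary: k l)
  case Nil
  then show ?case by auto
next
  case (Cons e es)
  have "orient V c es (k + unit_vec (fst e) - unit_vec (snd e)) = orient V d es (l + unit_vec (fst e) - unit_vec (snd e))"
    by (rule Cons.IH) (auto simp: Cons.prems)
  moreover have "orient V c es (k - unit_vec (fst e) + unit_vec (snd e)) = orient V d es (l - unit_vec (fst e) + unit_vec (snd e))"
    by (rule Cons.IH) (auto simp: Cons.prems)
  ultimately show ?case by simp
qed

text \<open>Reversing every edge negates the final excess, and the constraint at each vertex is
  symmetric.\<close>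

lemma orient_uminus: "orient V c es (- k) = orient V c es k"
proof (induction es arbitrary: k)
  case Nil
  then show ?case by auto
next
  case (Cons e es)
  have eqs: "- k + unit_vec (fst e) - unit_vec (snd e) = - (k - unit_vec (fst e) + unit_vec (snd e))"
    "- k - unit_vec (fst e) + unit_vec (snd e) = - (k + unit_vec (fst e) - unit_vec (snd e))"
    by (simp_all add: algebra_simps)
  show ?case
    unfolding orient.simps eqs Cons.IH by (rule add.commute)
qed

section \<open>Deleting a vertex\<close>

lemma sum_Pow_insert:
  assumes "finite I" "i \<notin> I"
  shows "(\<Sum>Z\<in>Pow (insert i I). g Z) = (\<Sum>Z\<in>Pow I. g Z + g (insert i Z))"
proof -
  have inj: "inj_on (insert i) (Pow I)"
    using assms(2) by (intro inj_onI) (metis PowD insert_ident subsetD)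
  have "(\<Sum>Z\<in>Pow (insert i I). g Z) = (\<Sum>Z\<in>Pow I. g Z) + (\<Sum>Z\<in>insert i ` Pow I. g Z)"
    unfolding Pow_insert using assms by (intro sum.union_disjoint) auto
  also have "\<dots> = (\<Sum>Z\<in>Pow I. g Z + g (insert i Z))"
    by (simp add: sum.reindex[OF inj] sum.distrib)
  finally show ?thesis .
qed

lemma signed_sum_insert_notin:
  assumes "finite I" "i \<notin> I" "Z \<subseteq> I"
  shows "signed_sum (u(i := b)) (insert i I) Z = signed_sum u I Z - unit_vec b"
proof -
  have "signed_sum (u(i := b)) I Z = signed_sum u I Z"
    unfolding signed_sum_def using assms by (intro sum.cong) auto
  moreover have "i \<notin> Z" using assms by auto
  ultimately show ?thesis using assms by (simp add: signed_sum_def)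
qed

lemma signed_sum_insert_in:
  assumes "finite I" "i \<notin> I"
  shows "signed_sum (u(i := b)) (insert i I) (insert i Z) = signed_sum u I Z + unit_vec b"
proof -
  have "(\<Sum>j\<in>I. if j \<in> insert i Z then unit_vec ((u(i := b)) j) else - unit_vec ((u(i := b)) j)) = signed_sum u I Z"
    unfolding signed_sum_def using assms by (intro sum.cong) auto
  then show ?thesis using assms by (simp add: signed_sum_def add.commute)
qed

text \<open>\<open>I\<close> indexes the non-loop edges at \<open>v\<close>, \<open>u i\<close> is the far end of edge \<open>i\<close>, and \<open>Z\<close> is the set of those
  edges that point towards \<open>v\<close>.\<close>
lemma orient_remove_vertex:
  fixes V :: "'v set"
  assumes "v \<notin> V"
  shows "\<exists>(I :: nat set) u es'. finite I \<and> (\<forall>c k. orient (insert v V) c es k =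
    (\<Sum>Z\<in>Pow I. if \<bar>k v - (2 * int (card Z) - int (card I))\<bar> \<le> c v
      then orient V c es' (k + signed_sum u I Z) else 0))"
proof (induction es)
  case Nil
  have "signed_sum u {} Z = 0" for u :: "nat \<Rightarrow> 'v" and Z
    by (simp add: signed_sum_def)
  then have "orient (insert v V) c [] k =
    (\<Sum>Z\<in>Pow {}. if \<bar>k v - (2 * int (card Z) - int (card ({} :: nat set)))\<bar> \<le> c v
      then orient V c [] (k + signed_sum u {} Z) else 0)" for c k and u :: "nat \<Rightarrow> 'v"
    by (simp only: Pow_empty) simp
  then show ?case by blast
next
  case (Cons e es)
  obtain a b where e: "e = (a, b)" by fastforce
  obtain I :: "nat set" and u es' where fin: "finite I" and IH: "\<And>c k. orient (insert v V) c es k =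
    (\<Sum>Z\<in>Pow I. if \<bar>k v - (2 * int (card Z) - int (card I))\<bar> \<le> c v
      then orient V c es' (k + signed_sum u I Z) else 0)"
    using Cons.IH by blast
  consider (away) "(a \<noteq> v \<and> b \<noteq> v) \<or> a = b" | (at) w where "w \<noteq> v" "(a = v \<and> b = w) \<or> (a = w \<and> b = v)"
    by (cases "a = v"; cases "b = v") auto
  then show ?case
  proof cases
    case away
    \<comment> \<open>A loop at \<open>v\<close> never changes the excess, so it stays in the list
      together with the edges that avoid \<open>v\<close>.\<close>
    have "orient (insert v V) c (e # es) k =
      (\<Sum>Z\<in>Pow I. if \<bar>k v - (2 * int (card Z) - int (card I))\<bar> \<le> c v
         then orient V c ((a, b) # es') (k + signed_sum u I Z) else 0)" for c k
    proof -
      have kv: "(k + unit_vec a - unit_vec b) v = k v" "(k - unit_vec a + unit_vec b) v = k v"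
        using away by (auto simp: unit_vec_def)
      have sh: "k + signed_sum u I Z + unit_vec a - unit_vec b = k + unit_vec a - unit_vec b + signed_sum u I Z"
        "k + signed_sum u I Z - unit_vec a + unit_vec b = k - unit_vec a + unit_vec b + signed_sum u I Z" for Z
        by (simp_all add: algebra_simps)
      show ?thesis
        unfolding e orient.simps fst_conv snd_conv IH kv sh
        by (subst sum.distrib[symmetric]) (intro sum.cong refl, auto)
    qed
    with fin show ?thesis by blast
  next
    case at
    obtain i where i: "i \<notin> I" using fin ex_new_if_finite infinite_UNIV_nat by blast
    let ?I = "insert i I" and ?u = "u(i := w)"
    have "orient (insert v V) c (e # es) k =
      (\<Sum>Z\<in>Pow ?I. if \<bar>k v - (2 * int (card Z) - int (card ?I))\<bar> \<le> c v
         then orient V c es' (k + signed_sum ?u ?I Z) else 0)" for c k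
    proof -
      have two: "orient (insert v V) c (e # es) k =
        orient (insert v V) c es (k + unit_vec v - unit_vec w) + orient (insert v V) c es (k - unit_vec v + unit_vec w)"
        using at(2) e by (auto simp: algebra_simps)
      have kv: "(k + unit_vec v - unit_vec w) v = k v + 1" "(k - unit_vec v + unit_vec w) v = k v - 1"
        using at(1) by (auto simp: unit_vec_def)
      \<comment> \<open>Since \<open>v\<close> is not in \<open>V\<close>, the smaller graph does
        not see the change at \<open>v\<close>; only the far end \<open>w\<close> matters.\<close>
      have drop: "orient V c es' (k + unit_vec v - unit_vec w + signed_sum u I Z) = orient V c es' (k + (signed_sum u I Z - unit_vec w))"
        "orient V c es' (k - unit_vec v + unit_vec w + signed_sum u I Z) = orient V c es' (k + (signed_sum u I Z + unit_vec w))" for Z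
        using assms by (auto intro!: orient_cong simp: unit_vec_def)
      have "(\<Sum>Z\<in>Pow ?I. if \<bar>k v - (2 * int (card Z) - int (card ?I))\<bar> \<le> c v
         then orient V c es' (k + signed_sum ?u ?I Z) else 0) =
        (\<Sum>Z\<in>Pow I. (if \<bar>k v + 1 - (2 * int (card Z) - int (card I))\<bar> \<le> c v
           then orient V c es' (k + (signed_sum u I Z - unit_vec w)) else 0) +
          (if \<bar>k v - 1 - (2 * int (card Z) - int (card I))\<bar> \<le> c v
           then orient V c es' (k + (signed_sum u I Z + unit_vec w)) else 0))"
        unfolding sum_Pow_insert[OF fin i]
      proof (rule sum.cong[OF refl])
        fix Z assume "Z \<in> Pow I"
        then have Z: "Z \<subseteq> I" "finite Z" "i \<notin> Z" using fin i finite_subset by auto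
        have c1: "k v - (2 * int (card Z) - int (card ?I)) = k v + 1 - (2 * int (card Z) - int (card I))"
          "k v - (2 * int (card (insert i Z)) - int (card ?I)) = k v - 1 - (2 * int (card Z) - int (card I))"
          using fin i Z by simp_all
        show "(if \<bar>k v - (2 * int (card Z) - int (card ?I))\<bar> \<le> c v
                 then orient V c es' (k + signed_sum ?u ?I Z) else 0) +
              (if \<bar>k v - (2 * int (card (insert i Z)) - int (card ?I))\<bar> \<le> c v
                 then orient V c es' (k + signed_sum ?u ?I (insert i Z)) else 0) =
              (if \<bar>k v + 1 - (2 * int (card Z) - int (card I))\<bar> \<le> c v
                 then orient V c es' (k + (signed_sum u I Z - unit_vec w)) else 0) +
              (if \<bar>k v - 1 - (2 * int (card Z) - int (card I))\<bar> \<le> c v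
                 then orient V c es' (k + (signed_sum u I Z + unit_vec w)) else 0)"
          unfolding c1 signed_sum_insert_notin[OF fin i Z(1)] signed_sum_insert_in[OF fin i] by (rule refl)
      qed
      then show ?thesis
        unfolding two IH kv drop by (simp only: sum.distrib)
    qed
    with fin show ?thesis by (meson finite_insert)
  qed
qed

section \<open>Splicing pairs of edges at the deleted vertex\<close>

text \<open>Double counting: a set of size \<open>Suc m\<close> arises as \<open>insert i Z\<close>
  once for each \<open>i\<close> inside it and \<open>j\<close> outside it. Exchanging the roles of
  \<open>i\<close> and \<open>j\<close> gives the factor 2.\<close>

lemma sum_over_split_pairs:
  fixes G :: "'i set \<Rightarrow> real"
  assumes fin: "finite I"
  shows "(\<Sum>i\<in>I. \<Sum>j\<in>I - {i}. \<Sum>Z | Z \<subseteq> I - {i, j} \<and> card Z = m. G (insert i Z) + G (insert j Z))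
    = 2 * real (Suc m) * real (card I - Suc m) * (\<Sum>Z | Z \<subseteq> I \<and> card Z = Suc m. G Z)"
proof -
  let ?F = "\<lambda>i j. \<Sum>Z | Z \<subseteq> I - {i, j} \<and> card Z = m. G (insert i Z)"
  have finZ: "finite {Z. Z \<subseteq> J \<and> card Z = m}" if "finite J" for J :: "'i set" and m
    using that by (auto intro: finite_subset[of _ "Pow J"])
  have one: "(\<Sum>i\<in>I. \<Sum>j\<in>I - {i}. ?F i j) =
    real (Suc m) * real (card I - Suc m) * (\<Sum>Z | Z \<subseteq> I \<and> card Z = Suc m. G Z)"
  proof -
    let ?A = "SIGMA i:I. SIGMA j:I - {i}. {Z. Z \<subseteq> I - {i, j} \<and> card Z = m}"
    let ?B = "SIGMA Z:{Z. Z \<subseteq> I \<and> card Z = Suc m}. Z \<times> (I - Z)"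
    have "(\<Sum>i\<in>I. \<Sum>j\<in>I - {i}. ?F i j) = (\<Sum>(i, j, Z)\<in>?A. G (insert i Z))"
      using fin finZ by (simp add: sum.Sigma finite_SigmaI case_prod_unfold)
    also have "\<dots> = (\<Sum>(Z, i, j)\<in>?B. G Z)"
      by (rule sum.reindex_bij_witness[of _ "\<lambda>(Z, i, j). (i, j, Z - {i})" "\<lambda>(i, j, Z). (insert i Z, i, j)"])
         (use fin in \<open>auto simp: card_insert_if insert_absorb finite_subset dest: finite_subset\<close>)
    also have "\<dots> = (\<Sum>Z | Z \<subseteq> I \<and> card Z = Suc m. \<Sum>p\<in>Z \<times> (I - Z). G Z)"
      using fin finZ by (subst sum.Sigma) (auto simp: case_prod_unfold dest: finite_subset)
    also have "\<dots> = (\<Sum>Z | Z \<subseteq> I \<and> card Z = Suc m. real (Suc m) * real (card I - Suc m) * G Z)"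
      using fin by (intro sum.cong refl) (auto simp: card_cartesian_product card_Diff_subset finite_subset algebra_simps)
    finally show ?thesis by (simp add: sum_distrib_left)
  qed
  have "(\<Sum>i\<in>I. \<Sum>j\<in>I - {i}. ?F j i) = (\<Sum>(i, j)\<in>(SIGMA i:I. I - {i}). ?F j i)"
    using fin by (intro sum.Sigma) auto
  also have "\<dots> = (\<Sum>(i, j)\<in>(SIGMA i:I. I - {i}). ?F i j)"
    by (rule sum.reindex_bij_witness[of _ "\<lambda>(i, j). (j, i)" "\<lambda>(i, j). (j, i)"]) auto
  also have "\<dots> = (\<Sum>i\<in>I. \<Sum>j\<in>I - {i}. ?F i j)"
    using fin by (intro sum.Sigma[symmetric]) auto
  finally have two: "(\<Sum>i\<in>I. \<Sum>j\<in>I - {i}. ?F j i) = (\<Sum>i\<in>I. \<Sum>j\<in>I - {i}. ?F i j)" .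
  have "(\<Sum>i\<in>I. \<Sum>j\<in>I - {i}. \<Sum>Z | Z \<subseteq> I - {i, j} \<and> card Z = m. G (insert i Z) + G (insert j Z)) =
    (\<Sum>i\<in>I. \<Sum>j\<in>I - {i}. ?F i j) + (\<Sum>i\<in>I. \<Sum>j\<in>I - {i}. ?F j i)"
    by (simp add: sum.distrib insert_commute)
  then show ?thesis using one two by simp
qed

text \<open>The hypotheses put \<open>m\<close> at least as close to \<open>d / 2\<close> as
  \<open>m'\<close>, so this is unimodality, after reflecting \<open>m'\<close> to
  \<open>d - m'\<close> if \<open>m\<close> lies in the lower half.\<close>

lemma binomial_middle_le:
  assumes "d - m' \<le> m" "m \<le> m'" "m' \<le> d"
  shows "d choose m' \<le> d choose m"
proof (cases "d \<le> 2 * m")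
  case True
  then show ?thesis using assms by (intro binomial_antimono) auto
next
  case False
  have "d choose (d - m') \<le> d choose m"
    using False assms by (intro binomial_mono) auto
  then show ?thesis using binomial_symmetric[of m' d] assms by simp
qed

text \<open>Trades the factor from \<open>sum_over_split_pairs\<close> for the change of binomial
  coefficient when two edges are spliced.\<close>

lemma binomial_absorb_twice:
  "real (Suc (Suc d) choose Suc p) * (real (Suc p) * real (Suc d - p)) =
   real (Suc (Suc d)) * real (Suc d) * real (d choose p)"
proof (cases "p \<le> d")
  case True
  have "Suc p * (Suc (Suc d) choose Suc p) = Suc (Suc d) * (Suc d choose p)"
    by (rule Suc_times_binomial)
  moreover have "(Suc d - p) * (Suc d choose p) = Suc d * (d choose p)"
    using binomial_absorb_comp[of "Suc d" p] by simp
  ultimately have "(Suc (Suc d) choose Suc p) * (Suc p * (Suc d - p)) = Suc (Suc d) * Suc d * (d choose p)"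
    by (metis (no_types, lifting) mult.assoc mult.commute)
  then show ?thesis by (metis of_nat_mult)
qed (auto simp: not_le binomial_eq_0)

definition level_sum ::
  "'v set \<Rightarrow> ('v \<Rightarrow> int) \<Rightarrow> ('v \<times> 'v) list \<Rightarrow> (nat \<Rightarrow> 'v) \<Rightarrow> nat set \<Rightarrow> nat \<Rightarrow> ('v \<Rightarrow> int) \<Rightarrow> real" where
  "level_sum V c es u I m k =
     (\<Sum>Z | Z \<subseteq> I \<and> card Z = m. orient V c es (k + signed_sum u I Z))"

lemma level_sum_nonneg: "0 \<le> level_sum V c es u I m k"
  unfolding level_sum_def by (intro sum_nonneg orient_nonneg)

text \<open>If exactly one of \<open>i\<close>, \<open>j\<close> points towards \<open>v\<close>,
  their far ends change as under one of the two orientations of an edge from \<open>u i\<close> to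
  \<open>u j\<close>.\<close>

lemma level_sum_contract:
  assumes fin: "finite I" and ij: "i \<in> I" "j \<in> I" "i \<noteq> j"
  shows "level_sum V c ((u i, u j) # es) u (I - {i, j}) m k =
    (\<Sum>Z | Z \<subseteq> I - {i, j} \<and> card Z = m.
       orient V c es (k + signed_sum u I (insert i Z)) + orient V c es (k + signed_sum u I (insert j Z)))"
  unfolding level_sum_def
proof (intro sum.cong refl)
  fix Z assume "Z \<in> {Z. Z \<subseteq> I - {i, j} \<and> card Z = m}"
  then have Z: "i \<notin> Z" "j \<notin> Z" by auto
  have I: "I = insert i (insert j (I - {i, j}))" using ij by auto
  have rest: "(\<Sum>l\<in>I - {i, j}. if l \<in> insert p Z then unit_vec (u l) else - unit_vec (u l)) = signed_sum u (I - {i, j}) Z"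
    if "p = i \<or> p = j" for p
    unfolding signed_sum_def using that by (intro sum.cong) auto
  have s1: "signed_sum u I (insert i Z) = unit_vec (u i) - unit_vec (u j) + signed_sum u (I - {i, j}) Z"
    unfolding signed_sum_def[of u I] by (subst I) (use fin ij Z rest[of i] in simp)
  have s2: "signed_sum u I (insert j Z) = unit_vec (u j) - unit_vec (u i) + signed_sum u (I - {i, j}) Z"
    unfolding signed_sum_def[of u I] by (subst I) (use fin ij Z rest[of j] in simp)
  show "orient V c ((u i, u j) # es) (k + signed_sum u (I - {i, j}) Z) =
    orient V c es (k + signed_sum u I (insert i Z)) + orient V c es (k + signed_sum u I (insert j Z))"
    unfolding s1 s2 by (simp add: algebra_simps)
qed

lemma signed_sum_full_bounds:
  "signed_sum u I I v - signed_sum u I Z v \<ge> 0" "signed_sum u I I v + signed_sum u I Z v \<ge> 0"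
  "even (signed_sum u I I v - signed_sum u I Z v)"
proof -
  have ev: "signed_sum u I Y v = (\<Sum>i\<in>I. if i \<in> Y then unit_vec (u i) v else - unit_vec (u i) v)" for Y
  proof (cases "finite I")
    case True
    then show ?thesis
      unfolding signed_sum_def by (induction I rule: finite_induct) auto
  qed (simp add: signed_sum_def)
  show "signed_sum u I I v - signed_sum u I Z v \<ge> 0" "signed_sum u I I v + signed_sum u I Z v \<ge> 0"
    "even (signed_sum u I I v - signed_sum u I Z v)"
    unfolding ev sum_subtractf[symmetric] sum.distrib[symmetric]
    by (auto intro!: sum_nonneg dvd_sum simp: unit_vec_def)
qed

text \<open>Handles the extreme level: with all edges pointing towards \<open>v\<close>, each far
  end gains as much as possible, and flipping an edge changes its far end by 2.\<close>

lemma dominates_signed_sum: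
  assumes "dominates x y"
  shows "dominates (x + signed_sum u I I) (y + signed_sum u I Z)"
  unfolding dominates_def
proof (intro allI conjI)
  fix v
  have xy: "\<bar>y v\<bar> \<le> x v" "even (x v - y v)" using assms by (auto simp: dominates_def)
  show "\<bar>(y + signed_sum u I Z) v\<bar> \<le> (x + signed_sum u I I) v"
    using xy signed_sum_full_bounds[of u I v Z] by auto
  have "even ((x v - y v) + (signed_sum u I I v - signed_sum u I Z v))"
    using xy(2) signed_sum_full_bounds(3) by (rule dvd_add)
  then show "even ((x + signed_sum u I I) v - (y + signed_sum u I Z) v)"
    by (simp add: algebra_simps)
qed

text \<open>Without the binomial factors the induction would not go through: contracting pairs multiplies
  the two sides by \<open>m' * (card I - m')\<close> and \<open>m * (card I - m)\<close>.\<close>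
lemma level_sum_le_normalised:
  assumes mono: "\<And>es x y. dominates x y \<Longrightarrow> orient V c es x \<le> orient V c es y"
    and xy: "dominates x y"
    and "finite I" "card I - m' \<le> m" "m \<le> m'" "m' \<le> card I"
  shows "level_sum V c es u I m' x * real (card I choose m) \<le> level_sum V c es u I m y * real (card I choose m')"
  using assms(3-)
proof (induction "card I - m'" arbitrary: I es m m')
  case 0
  then have m': "m' = card I" by simp
  have only: "{Z. Z \<subseteq> I \<and> card Z = card I} = {I}"
    using card_subset_eq[OF \<open>finite I\<close>] by auto
  \<comment> \<open>Only \<open>Z = I\<close> has size \<open>m'\<close>. The binomial factor
    repeats its term once for each set of size \<open>m\<close>, and the comparison is then
    termwise.\<close>
  have "level_sum V c es u I m' x * real (card I choose m) =
    (\<Sum>Z | Z \<subseteq> I \<and> card Z = m. orient V c es (x + signed_sum u I I))"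
    unfolding level_sum_def m' only using n_subsets[OF \<open>finite I\<close>, of m] by simp
  also have "\<dots> \<le> level_sum V c es u I m y"
    unfolding level_sum_def by (intro sum_mono mono dominates_signed_sum xy)
  finally show ?case by (simp add: m')
next
  case (Suc t)
  let ?d = "card I"
  \<comment> \<open>Here \<open>m' < card I\<close>, hence \<open>m\<close> is at least
    \<open>card I - m'\<close>, which is positive; so each level has a pair of opposite edges to
    splice.\<close>
  obtain p p' where p: "m = Suc p" "m' = Suc p'" using Suc.hyps(2) Suc.prems by (cases m; cases m') auto
  obtain d where d: "?d = Suc (Suc d)" using Suc.hyps(2) p by (cases "card I"; cases "card I - 1") auto
  have pd: "p \<le> d" "p' \<le> d" using Suc.hyps(2) Suc.prems p d by auto
  have tot: "(\<Sum>i\<in>I. \<Sum>j\<in>I - {i}. level_sum V c ((u i, u j) # es) u (I - {i, j}) q k) =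
    2 * real (Suc q) * real (Suc d - q) * level_sum V c es u I (Suc q) k" for q k
  proof -
    have "(\<Sum>i\<in>I. \<Sum>j\<in>I - {i}. level_sum V c ((u i, u j) # es) u (I - {i, j}) q k) =
      (\<Sum>i\<in>I. \<Sum>j\<in>I - {i}. \<Sum>Z | Z \<subseteq> I - {i, j} \<and> card Z = q.
         orient V c es (k + signed_sum u I (insert i Z)) + orient V c es (k + signed_sum u I (insert j Z)))"
      using Suc.prems by (intro sum.cong refl level_sum_contract) auto
    also have "\<dots> = 2 * real (Suc q) * real (Suc d - q) * level_sum V c es u I (Suc q) k"
      unfolding level_sum_def
      by (subst sum_over_split_pairs[OF \<open>finite I\<close>, where G = "\<lambda>Z. orient V c es (k + signed_sum u I Z)"])
         (simp add: d)
    finally show ?thesis .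
  qed
  have "level_sum V c ((u i, u j) # es) u (I - {i, j}) p' x * real (d choose p) \<le>
    level_sum V c ((u i, u j) # es) u (I - {i, j}) p y * real (d choose p')"
    if "i \<in> I" "j \<in> I - {i}" for i j
  proof -
    have card: "card (I - {i, j}) = d"
      using that Suc.prems(1) d by (auto simp: card_Diff_subset)
    show ?thesis
      using Suc.hyps(1)[of "I - {i, j}" p' p "(u i, u j) # es"] Suc.hyps(2) Suc.prems p d card by auto
  qed
  then have "(\<Sum>i\<in>I. \<Sum>j\<in>I - {i}. level_sum V c ((u i, u j) # es) u (I - {i, j}) p' x * real (d choose p)) \<le>
    (\<Sum>i\<in>I. \<Sum>j\<in>I - {i}. level_sum V c ((u i, u j) # es) u (I - {i, j}) p y * real (d choose p'))"
    by (intro sum_mono) auto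
  then have "(2 * real (Suc p') * real (Suc d - p') * level_sum V c es u I m' x) * real (d choose p) \<le>
    (2 * real (Suc p) * real (Suc d - p) * level_sum V c es u I m y) * real (d choose p')"
    by (simp only: sum_distrib_right[symmetric] tot p)
  \<comment> \<open>This multiplier lets \<open>binomial_absorb_twice\<close> restore the binomials
    of \<open>card I\<close>; both sides then share one positive factor, which cancels.\<close>
  then have "(real (Suc (Suc d)) * real (Suc d)) *
      ((2 * real (Suc p') * real (Suc d - p') * level_sum V c es u I m' x) * real (d choose p)) \<le>
    (real (Suc (Suc d)) * real (Suc d)) *
      ((2 * real (Suc p) * real (Suc d - p) * level_sum V c es u I m y) * real (d choose p'))"
    by (rule mult_left_mono) simp
  moreover have "(real (Suc (Suc d)) * real (Suc d)) *
      ((2 * real (Suc p') * real (Suc d - p') * level_sum V c es u I m' x) * real (d choose p)) =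
    (2 * real (Suc p') * real (Suc d - p') * level_sum V c es u I m' x) *
      (real (Suc (Suc d)) * real (Suc d) * real (d choose p))"
    by (simp only: mult_ac)
  moreover have "(real (Suc (Suc d)) * real (Suc d)) *
      ((2 * real (Suc p) * real (Suc d - p) * level_sum V c es u I m y) * real (d choose p')) =
    (2 * real (Suc p) * real (Suc d - p) * level_sum V c es u I m y) *
      (real (Suc (Suc d)) * real (Suc d) * real (d choose p'))"
    by (simp only: mult_ac)
  ultimately have "(real (Suc p') * real (Suc d - p') * real (Suc p) * real (Suc d - p)) *
      (level_sum V c es u I m' x * real (?d choose m)) \<le>
    (real (Suc p') * real (Suc d - p') * real (Suc p) * real (Suc d - p)) *
      (level_sum V c es u I m y * real (?d choose m'))"
    unfolding binomial_absorb_twice[symmetric] d p by (simp only: mult_ac)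
  moreover have "0 < real (Suc p') * real (Suc d - p') * real (Suc p) * real (Suc d - p)"
    using pd by simp
  ultimately show ?case by (simp only: mult_le_cancel_left_pos)
qed

lemma level_sum_le:
  assumes mono: "\<And>es x y. dominates x y \<Longrightarrow> orient V c es x \<le> orient V c es y"
    and xy: "dominates x y"
    and I: "finite I" "card I - m' \<le> m" "m \<le> m'" "m' \<le> card I"
  shows "level_sum V c es u I m' x \<le> level_sum V c es u I m y"
proof -
  have "level_sum V c es u I m' x * real (card I choose m) \<le> level_sum V c es u I m y * real (card I choose m')"
    using level_sum_le_normalised[OF mono xy I] by blast
  also have "\<dots> \<le> level_sum V c es u I m y * real (card I choose m)"
    using binomial_middle_le[OF I(2-4)] by (intro mult_left_mono level_sum_nonneg) simp
  finally show ?thesis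
    using I by (simp add: zero_less_binomial_iff)
qed

section \<open>Monotonicity of the orientation count\<close>

text \<open>Three pieces: the central block is assumed; the rest of the intersection has only
  positive \<open>s\<close> and is compared with itself; what remains is reflected by
  \<open>s\<close> to \<open>\<xi> + \<eta> - s\<close>.\<close>

lemma interval_sum_le:
  fixes a b :: "int \<Rightarrow> real"
  assumes h: "\<And>s t. \<bar>t\<bar> \<le> s \<Longrightarrow> even (s - t) \<Longrightarrow> b s \<le> a t"
    and centre: "sum b {\<xi> - c..c - \<xi>} \<le> sum a {\<xi> - c..c - \<xi>}"
    and ranges: "0 \<le> \<eta>" "\<eta> \<le> \<xi>" "even (\<xi> - \<eta>)"
  shows "sum b {\<xi> - c..\<xi> + c} \<le> sum a {\<eta> - c..\<eta> + c}"
proof -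
  let ?X = "{\<xi> - c..\<xi> + c}" and ?Y = "{\<eta> - c..\<eta> + c}" and ?J = "{\<xi> - c..c - \<xi>}"
  have sub: "?J \<subseteq> ?X \<inter> ?Y" using ranges by auto
  have split: "sum f A = sum f ?J + sum f (?X \<inter> ?Y - ?J) + sum f (A - ?X \<inter> ?Y)"
    if "finite A" "?X \<inter> ?Y \<subseteq> A" for f :: "int \<Rightarrow> real" and A
    using sum.subset_diff[OF that(2,1), of f] sum.subset_diff[OF sub, of f] by simp
  have "sum b (?X \<inter> ?Y - ?J) \<le> sum a (?X \<inter> ?Y - ?J)"
    by (intro sum_mono h) auto
  moreover have "sum b (?X - ?X \<inter> ?Y) \<le> sum a (?Y - ?X \<inter> ?Y)"
  proof -
    have "sum b (?X - ?X \<inter> ?Y) \<le> (\<Sum>s\<in>?X - ?X \<inter> ?Y. a (\<xi> + \<eta> - s))"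
    proof (intro sum_mono h)
      fix s assume s: "s \<in> ?X - ?X \<inter> ?Y"
      \<comment> \<open>Adding \<open>s > \<eta> + c\<close> and \<open>s \<ge> \<xi> - c\<close>
        gives \<open>2 * s > \<xi> + \<eta>\<close>.\<close>
      then show "\<bar>\<xi> + \<eta> - s\<bar> \<le> s" using ranges by auto
      show "even (s - (\<xi> + \<eta> - s))" using ranges(3) by presburger
    qed
    also have "\<dots> = sum a (?Y - ?X \<inter> ?Y)"
      by (rule sum.reindex_bij_witness[of _ "\<lambda>s. \<xi> + \<eta> - s" "\<lambda>s. \<xi> + \<eta> - s"]) auto
    finally show ?thesis .
  qed
  ultimately show ?thesis
    using split[of ?X b, OF finite_atLeastAtMost_int Int_lower1]
      split[of ?Y a, OF finite_atLeastAtMost_int Int_lower2] centre by linarith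
qed

lemma orient_antimono_nonneg:
  assumes mono: "\<And>es x y. dominates x y \<Longrightarrow> orient V c es x \<le> orient V c es y"
    and v: "v \<notin> V"
    and xy: "dominates x y" and y: "0 \<le> y v"
    and centre: "orient (insert v V) (c(v := c v - x v)) es (x(v := 0)) \<le>
      orient (insert v V) (c(v := c v - x v)) es (y(v := 0))"
  shows "orient (insert v V) c es x \<le> orient (insert v V) c es y"
proof -
  obtain I :: "nat set" and u es' where fin: "finite I" and remove: "\<And>c k. orient (insert v V) c es k =
    (\<Sum>Z\<in>Pow I. if \<bar>k v - (2 * int (card Z) - int (card I))\<bar> \<le> c v
      then orient V c es' (k + signed_sum u I Z) else 0)"
    using orient_remove_vertex[OF v, of es] by blast
  define lev where "lev k s = (\<Sum>Z | Z \<subseteq> I \<and> 2 * int (card Z) - int (card I) = s.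
    orient V c es' (k + signed_sum u I Z))" for k s
  have by_level: "(\<Sum>Z\<in>Pow I. if \<bar>w - (2 * int (card Z) - int (card I))\<bar> \<le> r
      then orient V c es' (k + signed_sum u I Z) else 0) = sum (lev k) {w - r..w + r}" for w r k
  proof -
    let ?s = "\<lambda>Z. 2 * int (card Z) - int (card I)"
    have "(\<Sum>Z\<in>Pow I. if \<bar>w - ?s Z\<bar> \<le> r then orient V c es' (k + signed_sum u I Z) else 0) =
      (\<Sum>Z | Z \<subseteq> I \<and> ?s Z \<in> {w - r..w + r}. orient V c es' (k + signed_sum u I Z))"
      using fin by (subst sum.inter_filter[symmetric]) (auto intro!: sum.cong)
    also have "\<dots> = (\<Sum>s\<in>{w - r..w + r}. \<Sum>Z | Z \<in> {Z. Z \<subseteq> I \<and> ?s Z \<in> {w - r..w + r}} \<and> ?s Z = s.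
        orient V c es' (k + signed_sum u I Z))"
      using fin by (intro sum.group[symmetric]) auto
    also have "\<dots> = sum (lev k) {w - r..w + r}"
      unfolding lev_def by (intro sum.cong) auto
    finally show ?thesis .
  qed
  have lev_le: "lev x s \<le> lev y t" if st: "\<bar>t\<bar> \<le> s" "even (s - t)" for s t
  proof (cases "\<exists>Z\<subseteq>I. 2 * int (card Z) - int (card I) = s")
    case False
    then have none: "{Z. Z \<subseteq> I \<and> 2 * int (card Z) - int (card I) = s} = {}" by auto
    have "lev x s = 0" unfolding lev_def none by simp
    also have "\<dots> \<le> lev y t" unfolding lev_def by (intro sum_nonneg orient_nonneg)
    finally show ?thesis .
  next
    case True
    then obtain Z where Z: "Z \<subseteq> I" "2 * int (card Z) - int (card I) = s" by blast
    obtain e where e: "s - t = 2 * e" using st(2) by blast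
    \<comment> \<open>Going down from level \<open>s\<close> to \<open>t\<close> turns
      \<open>e\<close> edges away from \<open>v\<close>; \<open>t \<ge> - s\<close> keeps the
      resulting number nonnegative.\<close>
    define m where "m = nat (int (card Z) - e)"
    have le: "card Z \<le> card I" using Z fin by (simp add: card_mono)
    have m: "int m = int (card Z) - e" unfolding m_def using e st Z le by auto
    have eqx: "lev x s = level_sum V c es' u I (card Z) x"
      unfolding lev_def level_sum_def using Z by (intro sum.cong) auto
    have eqy: "lev y t = level_sum V c es' u I m y"
      unfolding lev_def level_sum_def using Z e m by (intro sum.cong) auto
    show ?thesis
      unfolding eqx eqy
      by (rule level_sum_le[OF mono xy fin]) (use e st Z le m in auto)
  qed
  have full: "orient (insert v V) c es k = sum (lev k) {k v - c v..k v + c v}" for k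
    unfolding remove by_level ..
  \<comment> \<open>Excess 0 with bound \<open>c v - x v\<close> selects exactly the symmetric block
    of levels, for \<open>x\<close> and for \<open>y\<close> alike.\<close>
  have central: "orient (insert v V) (c(v := c v - x v)) es (k(v := 0)) = sum (lev k) {x v - c v..c v - x v}" for k
  proof -
    have shift: "orient V (c(v := c v - x v)) es' (k(v := 0) + z) = orient V c es' (k + z)" for z
      using v by (intro orient_cong) auto
    show ?thesis
      unfolding remove fun_upd_same shift by_level by simp
  qed
  have "\<bar>y v\<bar> \<le> x v" "even (x v - y v)" using xy by (auto simp: dominates_def)
  then show ?thesis
    unfolding full using centre y unfolding central
    by (intro interval_sum_le lev_le) auto
qed

text \<open>The outer hypothesis must cover all edge lists, because splicing adds edges. The inner
  one keeps the graph but must allow other bounds, because centring \<open>v\<close> replaces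
  \<open>c v\<close> by \<open>c v - x v\<close>.\<close>

lemma orient_antimono:
  assumes "finite V" "dominates x y"
  shows "orient V c es x \<le> orient V c es y"
  using assms
proof (induction V arbitrary: c es x y rule: measure_induct_rule[where f = card])
  case (less V)
  note outer = less.IH
  from \<open>dominates x y\<close> show ?case
  proof (induction "card {v \<in> V. x v \<noteq> 0}" arbitrary: c x y rule: less_induct)
    case less
    show ?case
    proof (cases "\<exists>v\<in>V. x v \<noteq> 0")
      case False
      have "y v = x v" if "v \<in> V" for v
        using that False \<open>dominates x y\<close> unfolding dominates_def by (metis abs_le_zero_iff)
      then show ?thesis by (intro eq_refl orient_cong) auto
    next
      case True
      then obtain v where v: "v \<in> V" "x v \<noteq> 0" by blast
      define W where "W = V - {v}"
      have W: "V = insert v W" "v \<notin> W" "finite W"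
        using v \<open>finite V\<close> by (auto simp: W_def)
      have card_W: "card W < card V"
        unfolding W_def by (rule card_Diff1_less[OF \<open>finite V\<close> v(1)])
      have mono: "orient W c es x \<le> orient W c es y" if "dominates x y" for es x y
        using outer[OF card_W W(3) that] .
      have fewer: "card {w \<in> V. (x(v := 0)) w \<noteq> 0} < card {w \<in> V. x w \<noteq> 0}"
        using v \<open>finite V\<close> by (intro psubset_card_mono) auto
      have main: "orient V c es x \<le> orient V c es z" if z: "dominates x z" "0 \<le> z v" for z
      proof -
        have "dominates (x(v := 0)) (z(v := 0))"
          using z(1) by (auto simp: dominates_def)
        from less.hyps[OF fewer this] show ?thesis
          unfolding W(1) by (intro orient_antimono_nonneg[OF mono W(2) z])
      qed
      show ?thesis
      proof (cases "0 \<le> y v")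
        case True
        then show ?thesis using main less.prems by blast
      next
        case False
        \<comment> \<open>A negative \<open>y v\<close> is made positive by reversing all edges on
          the \<open>y\<close> side only.\<close>
        have "dominates x (- y)"
          using less.prems by (auto simp: dominates_def)
        then have "orient V c es x \<le> orient V c es (- y)"
          using False by (intro main) auto
        then show ?thesis by (simp only: orient_uminus)
      qed
    qed
  qed
qed

section \<open>From pairs of assignments to orientations\<close>

text \<open>\<open>p\<close> and \<open>q\<close> are the occupancies of the two assignments; an edge \<open>(u, v)\<close> is a ball of both of them
  that goes to \<open>u\<close> in one and to \<open>v\<close> in the other.\<close>
primrec pair_orient ::
  "'v set \<Rightarrow> ('v \<Rightarrow> int) \<Rightarrow> ('v \<Rightarrow> int) \<Rightarrow> ('v \<times> 'v) list \<Rightarrow> ('v \<Rightarrow> int) \<Rightarrow> ('v \<Rightarrow> int) \<Rightarrow> real" where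
  "pair_orient K S T [] p q =
     (if \<forall>j\<in>K. S j \<le> p j \<and> p j \<le> T j \<and> S j \<le> q j \<and> q j \<le> T j then 1 else 0)"
| "pair_orient K S T (e # es) p q =
     pair_orient K S T es (p + unit_vec (fst e)) (q + unit_vec (snd e)) +
     pair_orient K S T es (p + unit_vec (snd e)) (q + unit_vec (fst e))"

text \<open>Each edge adds both its ends to the total \<open>p + q\<close>, whichever way it is
  oriented, so the final total is known in advance and \<open>c\<close> can be chosen independently
  of \<open>p\<close> and \<open>q\<close>.\<close>

lemma pair_orient_eq_orient:
  fixes D :: "'v \<Rightarrow> int"
  shows "\<exists>c. \<forall>p q. p + q = D \<longrightarrow> pair_orient K S T es p q = orient K c es (p - q)"
proof (induction es arbitrary: D)
  case Nil
  have eq: "(S j \<le> p j \<and> p j \<le> T j \<and> S j \<le> q j \<and> q j \<le> T j) =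
    (\<bar>(p - q) j\<bar> \<le> min (2 * T j - D j) (D j - 2 * S j))"
    if "p + q = D" for p q :: "'v \<Rightarrow> int" and j
    using that by auto
  \<comment> \<open>With total \<open>D\<close>, the larger occupancy is half of
    \<open>D j + \<bar>p j - q j\<bar>\<close> and the smaller half of
    \<open>D j - \<bar>p j - q j\<bar>\<close>; bounding them by \<open>T j\<close> and
    \<open>S j\<close> gives the minimum.\<close>
  show ?case
    by (intro exI[of _ "\<lambda>j. min (2 * T j - D j) (D j - 2 * S j)"] allI impI) (simp only: eq orient.simps pair_orient.simps)
next
  case (Cons e es)
  obtain c where c: "\<And>p q. p + q = D + unit_vec (fst e) + unit_vec (snd e) \<Longrightarrow>
      pair_orient K S T es p q = orient K c es (p - q)"
    using Cons.IH[of "D + unit_vec (fst e) + unit_vec (snd e)"] by blast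
  have "pair_orient K S T (e # es) p q = orient K c (e # es) (p - q)" if "p + q = D" for p q
  proof -
    have "pair_orient K S T es (p + unit_vec (fst e)) (q + unit_vec (snd e)) =
        orient K c es ((p - q) + unit_vec (fst e) - unit_vec (snd e))"
      using that by (subst c) (auto simp: algebra_simps)
    moreover have "pair_orient K S T es (p + unit_vec (snd e)) (q + unit_vec (fst e)) =
        orient K c es ((p - q) - unit_vec (fst e) + unit_vec (snd e))"
      using that by (subst c) (auto simp: algebra_simps)
    ultimately show ?thesis by simp
  qed
  then show ?case by blast
qed

lemma pair_orient_antimono:
  assumes "finite K" "p + q = p' + q'" "dominates (p - q) (p' - q')"
  shows "pair_orient K S T es p q \<le> pair_orient K S T es p' q'"
proof -
  obtain c where "\<And>r s. r + s = p + q \<Longrightarrow> pair_orient K S T es r s = orient K c es (r - s)"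
    using pair_orient_eq_orient[of "p + q" K S T es] by blast
  then show ?thesis using orient_antimono assms by metis
qed

definition weight :: "(nat \<Rightarrow> 'v \<Rightarrow> real) \<Rightarrow> nat set \<Rightarrow> (nat \<Rightarrow> 'v) \<Rightarrow> real" where
  "weight \<gamma> A \<sigma> = (\<Prod>i\<in>A. \<gamma> i (\<sigma> i))"

definition occupancy :: "nat set \<Rightarrow> (nat \<Rightarrow> 'v) \<Rightarrow> 'v \<Rightarrow> int" where
  "occupancy A \<sigma> = (\<Sum>i\<in>A. unit_vec (\<sigma> i))"

lemma occupancy_apply:
  assumes "finite A"
  shows "occupancy A \<sigma> j = int (card {i \<in> A. \<sigma> i = j})"
proof -
  have "occupancy A \<sigma> j = (\<Sum>i\<in>A. if \<sigma> i = j then 1 else 0)"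
    unfolding occupancy_def using assms
    by (induction A rule: finite_induct) (auto simp: unit_vec_def)
  also have "\<dots> = (\<Sum>i | i \<in> A \<and> \<sigma> i = j. 1)"
    using assms by (rule sum.inter_filter[symmetric])
  finally show ?thesis by simp
qed

text \<open>A partially processed pair: \<open>p\<close> and \<open>q\<close> record balls already
  placed, \<open>es\<close> holds common balls placed up to a swap, and \<open>A\<close>,
  \<open>B\<close> hold the balls still to be placed.\<close>

definition pair_sum where
  "pair_sum K \<gamma> S T A B es p q =
     (\<Sum>\<sigma>\<in>A \<rightarrow>\<^sub>E K. \<Sum>\<tau>\<in>B \<rightarrow>\<^sub>E K.
        weight \<gamma> A \<sigma> * weight \<gamma> B \<tau> * pair_orient K S T es (p + occupancy A \<sigma>) (q + occupancy B \<tau>))"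

lemma sum_PiE_insert:
  assumes "finite C" "i \<notin> C" "finite K"
  shows "(\<Sum>\<sigma>\<in>insert i C \<rightarrow>\<^sub>E K. g \<sigma>) = (\<Sum>u\<in>K. \<Sum>\<sigma>\<in>C \<rightarrow>\<^sub>E K. g (\<sigma>(i := u)))"
proof -
  have "(\<Sum>\<sigma>\<in>insert i C \<rightarrow>\<^sub>E K. g \<sigma>) = (\<Sum>(u, \<sigma>)\<in>K \<times> (C \<rightarrow>\<^sub>E K). g (\<sigma>(i := u)))"
    unfolding PiE_insert_eq using inj_combinator[OF assms(2), of "\<lambda>_. K"]
    by (subst sum.reindex) (auto simp: case_prod_unfold)
  then show ?thesis using assms by (simp add: sum.cartesian_product)
qed

lemma weight_insert:
  assumes "finite C" "i \<notin> C"
  shows "weight \<gamma> (insert i C) (\<sigma>(i := u)) = \<gamma> i u * weight \<gamma> C \<sigma>"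
proof -
  have "(\<Prod>j\<in>C. \<gamma> j ((\<sigma>(i := u)) j)) = (\<Prod>j\<in>C. \<gamma> j (\<sigma> j))"
    using assms by (intro prod.cong) auto
  then show ?thesis using assms by (simp add: weight_def)
qed

lemma occupancy_insert:
  assumes "finite C" "i \<notin> C"
  shows "occupancy (insert i C) (\<sigma>(i := u)) = unit_vec u + occupancy C \<sigma>"
proof -
  have "(\<Sum>j\<in>C. unit_vec ((\<sigma>(i := u)) j)) = (\<Sum>j\<in>C. unit_vec (\<sigma> j))"
    using assms by (intro sum.cong) auto
  then show ?thesis using assms by (simp add: occupancy_def)
qed

lemma pair_sum_insert_left:
  assumes "finite A" "i \<notin> A" "finite K"
  shows "pair_sum K \<gamma> S T (insert i A) B es p q = (\<Sum>u\<in>K. \<gamma> i u * pair_sum K \<gamma> S T A B es (p + unit_vec u) q)"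
  unfolding pair_sum_def sum_PiE_insert[OF assms] weight_insert[OF assms(1,2)] occupancy_insert[OF assms(1,2)]
  by (simp add: sum_distrib_left algebra_simps)

lemma pair_sum_insert_right:
  assumes "finite B" "i \<notin> B" "finite K"
  shows "pair_sum K \<gamma> S T A (insert i B) es p q = (\<Sum>u\<in>K. \<gamma> i u * pair_sum K \<gamma> S T A B es p (q + unit_vec u))"
  unfolding pair_sum_def sum_PiE_insert[OF assms] weight_insert[OF assms(1,2)] occupancy_insert[OF assms(1,2)]
  by (subst sum.swap) (simp add: sum_distrib_left algebra_simps)

lemma pair_sum_Cons:
  "pair_sum K \<gamma> S T A B ((u, v) # es) p q =
     pair_sum K \<gamma> S T A B es (p + unit_vec u) (q + unit_vec v) +
     pair_sum K \<gamma> S T A B es (p + unit_vec v) (q + unit_vec u)"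
  unfolding pair_sum_def by (simp add: sum.distrib algebra_simps)

text \<open>Symmetrising over the urns \<open>u\<close>, \<open>v\<close> of a common ball keeps its
  weight; the edge counts both orders, hence the 2.\<close>

lemma pair_sum_insert_both:
  assumes "finite C" "i \<notin> C" "finite K"
  shows "2 * pair_sum K \<gamma> S T (insert i C) (insert i C) es p q =
    (\<Sum>u\<in>K. \<Sum>v\<in>K. \<gamma> i u * \<gamma> i v * pair_sum K \<gamma> S T C C ((u, v) # es) p q)"
proof -
  let ?g = "\<lambda>u v. \<gamma> i u * \<gamma> i v * pair_sum K \<gamma> S T C C es (p + unit_vec u) (q + unit_vec v)"
  let ?g' = "\<lambda>u v. \<gamma> i u * \<gamma> i v * pair_sum K \<gamma> S T C C es (p + unit_vec v) (q + unit_vec u)"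
  have "pair_sum K \<gamma> S T (insert i C) (insert i C) es p q = (\<Sum>u\<in>K. \<Sum>v\<in>K. ?g u v)"
    unfolding pair_sum_insert_left[OF assms]
    by (simp only: pair_sum_insert_right[OF assms] sum_distrib_left mult.assoc)
  moreover have "(\<Sum>u\<in>K. \<Sum>v\<in>K. ?g u v) = (\<Sum>u\<in>K. \<Sum>v\<in>K. ?g' u v)"
    by (rule trans[OF sum.swap]) (simp only: mult.commute)
  moreover have "(\<Sum>u\<in>K. \<Sum>v\<in>K. \<gamma> i u * \<gamma> i v * pair_sum K \<gamma> S T C C ((u, v) # es) p q) =
    (\<Sum>u\<in>K. \<Sum>v\<in>K. ?g u v) + (\<Sum>u\<in>K. \<Sum>v\<in>K. ?g' u v)"
    by (simp only: pair_sum_Cons distrib_left sum.distrib)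
  ultimately show ?thesis by linarith
qed

text \<open>Every common ball becomes an edge, so \<open>p\<close> and \<open>q\<close> stay fixed
  while \<open>es\<close> grows, until \<open>pair_orient_antimono\<close> applies.\<close>

lemma pair_sum_common_le:
  assumes "finite C" "finite K" "\<And>i j. i \<in> C \<Longrightarrow> j \<in> K \<Longrightarrow> 0 \<le> \<gamma> i j"
    and "p + q = p' + q'" "dominates (p - q) (p' - q')"
  shows "pair_sum K \<gamma> S T C C es p q \<le> pair_sum K \<gamma> S T C C es p' q'"
  using assms(1,3)
proof (induction C arbitrary: es rule: finite_induct)
  case empty
  then show ?case
    using pair_orient_antimono[OF \<open>finite K\<close> assms(4,5)]
    by (simp add: pair_sum_def weight_def occupancy_def)
next
  case (insert i C)
  have "2 * pair_sum K \<gamma> S T (insert i C) (insert i C) es p q \<le>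
    2 * pair_sum K \<gamma> S T (insert i C) (insert i C) es p' q'"
    unfolding pair_sum_insert_both[OF insert.hyps(1,2) \<open>finite K\<close>]
    by (intro sum_mono mult_left_mono insert.IH mult_nonneg_nonneg) (auto intro: insert.prems)
  then show ?case by simp
qed

text \<open>The first form serves a ball on the same side in both products, the second a ball that
  changes sides.\<close>

lemma dominates_add_unit:
  assumes "dominates x y"
  shows "dominates (x + unit_vec u) (y + unit_vec u)" "dominates (x + unit_vec u) (y - unit_vec u)"
proof -
  have xy: "\<bar>y v\<bar> \<le> x v" "even (x v - y v)" for v using assms by (auto simp: dominates_def)
  show "dominates (x + unit_vec u) (y + unit_vec u)" "dominates (x + unit_vec u) (y - unit_vec u)"
    unfolding dominates_def using xy by (auto simp: unit_vec_def intro: abs_leI order_trans) (smt (verit) xy(1))+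
qed

lemma pair_sum_left_le:
  assumes "finite A" "finite C" "A \<inter> C = {}" "finite K"
    and "\<And>i j. i \<in> A \<union> C \<Longrightarrow> j \<in> K \<Longrightarrow> 0 \<le> \<gamma> i j"
    and "p + q = p' + q'" "dominates (p - q) (p' - q')"
  shows "pair_sum K \<gamma> S T (A \<union> C) C es p q \<le> pair_sum K \<gamma> S T (A \<union> C) C es p' q'"
  using assms(1,3,5-)
proof (induction A arbitrary: p p' rule: finite_induct)
  case empty
  show ?case
    unfolding Un_empty_left
    by (rule pair_sum_common_le[OF assms(2,4) _ empty.prems(3,4)]) (use empty.prems(2) in auto)
next
  case (insert i A)
  have i: "i \<notin> A \<union> C" "finite (A \<union> C)" using insert.hyps insert.prems \<open>finite C\<close> by auto
  show ?case
    unfolding Un_insert_left pair_sum_insert_left[OF i(2,1) \<open>finite K\<close>]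
  proof (intro sum_mono mult_left_mono insert.IH)
    fix u
    show "p + unit_vec u + q = p' + unit_vec u + q'"
      using insert.prems(3) by (metis add.assoc add.commute)
    have "p + unit_vec u - q = p - q + unit_vec u" "p' + unit_vec u - q' = p' - q' + unit_vec u"
      by (simp_all add: fun_eq_iff)
    then show "dominates (p + unit_vec u - q) (p' + unit_vec u - q')"
      using dominates_add_unit(1)[OF insert.prems(4), of u] by (simp only:)
  qed (use insert.prems in auto)
qed

text \<open>A ball of \<open>B\<close> raises \<open>p\<close> on the left but \<open>q'\<close> on
  the right: the totals still agree, and the excesses move by opposite units.\<close>

lemma pair_sum_union_le:
  assumes "finite A" "finite B" "finite C" "A \<inter> C = {}" "B \<inter> (A \<union> C) = {}" "finite K"
    and "\<And>i j. i \<in> A \<union> B \<union> C \<Longrightarrow> j \<in> K \<Longrightarrow> 0 \<le> \<gamma> i j"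
    and "p + q = p' + q'" "dominates (p - q) (p' - q')"
  shows "pair_sum K \<gamma> S T (B \<union> (A \<union> C)) C es p q \<le> pair_sum K \<gamma> S T (A \<union> C) (B \<union> C) es p' q'"
  using assms(2,5,7-)
proof (induction B arbitrary: p q' rule: finite_induct)
  case empty
  show ?case
    unfolding Un_empty_left
    by (rule pair_sum_left_le[OF assms(1,3,4,6) _ empty.prems(3,4)]) (use empty.prems(2) in auto)
next
  case (insert i B)
  have i: "i \<notin> B \<union> (A \<union> C)" "finite (B \<union> (A \<union> C))" "i \<notin> B \<union> C" "finite (B \<union> C)"
    using insert.hyps insert.prems assms(1,3) by auto
  show ?case
    unfolding Un_insert_left pair_sum_insert_left[OF i(2,1) \<open>finite K\<close>] pair_sum_insert_right[OF i(4,3) \<open>finite K\<close>]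
  proof (intro sum_mono mult_left_mono insert.IH)
    fix u
    show "p + unit_vec u + q = p' + (q' + unit_vec u)"
      using insert.prems(3) by (metis add.assoc add.commute)
    have "p + unit_vec u - q = p - q + unit_vec u" "p' - (q' + unit_vec u) = p' - q' - unit_vec u"
      by (simp_all add: fun_eq_iff)
    then show "dominates (p + unit_vec u - q) (p' - (q' + unit_vec u))"
      using dominates_add_unit(2)[OF insert.prems(4), of u] by (simp only:)
  qed (use insert.prems in auto)
qed

lemma occupancy_sum_mult_eq_pair_sum:
  assumes "finite A" "finite B" "finite K"
  shows "occupancy_sum K \<gamma> S T A * occupancy_sum K \<gamma> S T B = pair_sum K \<gamma> S T A B [] 0 0"
proof -
  have occ: "occupancy_sum K \<gamma> S T A =
    (\<Sum>\<sigma>\<in>A \<rightarrow>\<^sub>E K. if \<forall>j\<in>K. S j \<le> occupancy A \<sigma> j \<and> occupancy A \<sigma> j \<le> T j then weight \<gamma> A \<sigma> else 0)"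
    if "finite A" for A
  proof -
    have "finite (A \<rightarrow>\<^sub>E K)" using that assms(3) by (intro finite_PiE) auto
    then show ?thesis
      unfolding occupancy_sum_def weight_def occupancy_apply[OF that]
      by (subst sum.inter_filter[symmetric]) auto
  qed
  show ?thesis
    unfolding occ[OF assms(1)] occ[OF assms(2)] sum_product pair_sum_def
    by (intro sum.cong refl) auto
qed

theorem mainTheorem6:
  fixes m n :: nat and \<gamma> :: "nat \<Rightarrow> nat \<Rightarrow> real" and S T :: "nat \<Rightarrow> int"
  assumes "m \<ge> 1" and "n \<ge> 1"
    and "\<And>i j. i \<in> {1..m} \<Longrightarrow> j \<in> {1..n} \<Longrightarrow> 0 \<le> \<gamma> i j"
    and "\<And>j. j \<in> {1..n - 1} \<Longrightarrow> 0 \<le> S j \<and> S j \<le> T j \<and> T j \<le> int m"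
  shows "negative_lattice_condition {1..m} (occupancy_sum {1..n - 1} \<gamma> S T)"
  unfolding negative_lattice_condition_def
proof (intro allI impI)
  fix A B assume AB: "A \<subseteq> {1..m}" "B \<subseteq> {1..m}"
  then have fin: "finite A" "finite B" using finite_subset by blast+
  let ?K = "{1..n - 1}"
  have sets: "B - A \<union> A = A \<union> B" "A - B \<union> A \<inter> B = A" "B - A \<union> A \<inter> B = B"
    by auto
  \<comment> \<open>No ball is placed yet, so both initial excesses are 0.\<close>
  have "pair_sum ?K \<gamma> S T (B - A \<union> (A - B \<union> A \<inter> B)) (A \<inter> B) [] 0 0 \<le>
    pair_sum ?K \<gamma> S T (A - B \<union> A \<inter> B) (B - A \<union> A \<inter> B) [] 0 0"
  proof (rule pair_sum_union_le)
    show "0 \<le> \<gamma> i j" if "i \<in> A - B \<union> (B - A) \<union> A \<inter> B" "j \<in> ?K" for i j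
      using that AB by (intro assms(3)) auto
  qed (use fin in \<open>auto simp: dominates_def\<close>)
  then show "occupancy_sum ?K \<gamma> S T (A \<union> B) * occupancy_sum ?K \<gamma> S T (A \<inter> B) \<le>
    occupancy_sum ?K \<gamma> S T A * occupancy_sum ?K \<gamma> S T B"
    unfolding sets using fin by (simp add: occupancy_sum_mult_eq_pair_sum)
qed

end
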